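(* Let $u,v\in\mathbb{N}$ and let $A$ be a $u\times v$ matrix with entries from $\mathbb{N}\cup\{0\}$ such that no row of $A$ is zero. Let $S\subseteq(0,\infty)$ be a dense subsemigroup of $([0,\infty),+)$. Assume that for every central set near zero $C$ in $S$ there exists $\vec{x}\in S^v$ such that $A\vec{x}\in C^u$. Then for every central set near zero $C$ in $S$, the set $\{\vec{x}\in S^v:A\vec{x}\in C^u\}$ is central near zero in $S^v$.
   Context: $[0,\infty)^k$ carries the Euclidean topology and coordinatewise addition; for $S^v\subseteq[0,\infty)^v$, "near zero" means near $\overline 0=(0,\dots,0)$. For a semigroup $S'$ (here $S$ or $S^v$), $\beta S'$ is the set of ultrafilters on $S'$ with $p+q=\{X:\{s:-s+X\in q\}\in p\}$, $-s+X=\{t:s+t\in X\}$; $0_{S'}^*=\{p\in\beta S': U\cap S'\in p$ for every neighborhood $U$ of $\overline 0\}$ is a compact subsemigroup with smallest ideal $K(0_{S'}^* )$. A set $C\subseteq S'$ is central near zero if $C\in p$ for some idempotent $p\in K(0_{S'}^* )$. *)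

theory Defs
  imports "HOL-Analysis.Analysis"
begin

(* An ultrafilter on the set S is represented as the collection of its members, all of which
   are subsets of S. *)
definition ultrafilter_on :: "'a set \<Rightarrow> 'a set set \<Rightarrow> bool" where
  "ultrafilter_on S p \<longleftrightarrow>
     p \<subseteq> Pow S \<and> S \<in> p \<and> {} \<notin> p \<and>
     (\<forall>X\<in>p. \<forall>Y\<in>p. X \<inter> Y \<in> p) \<and>
     (\<forall>X\<in>p. \<forall>Y. X \<subseteq> Y \<and> Y \<subseteq> S \<longrightarrow> Y \<in> p) \<and>
     (\<forall>X. X \<subseteq> S \<longrightarrow> X \<in> p \<or> S - X \<in> p)"

definition ultrafilters :: "'a set \<Rightarrow> 'a set set set" where
  "ultrafilters S = {p. ultrafilter_on S p}"

(* -s + X, formed inside S *)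
definition left_translate :: "'a::plus set \<Rightarrow> 'a \<Rightarrow> 'a set \<Rightarrow> 'a set" where
  "left_translate S s X = {t \<in> S. s + t \<in> X}"

definition ultrafilter_add :: "'a::plus set \<Rightarrow> 'a set set \<Rightarrow> 'a set set \<Rightarrow> 'a set set" where
  "ultrafilter_add S p q = {X. X \<subseteq> S \<and> {s \<in> S. left_translate S s X \<in> q} \<in> p}"

(* As ultrafilters are upward closed, the open neighborhoods of 0 suffice. For a set S of vectors
   with nonnegative coordinates, neighborhoods of 0 in the ambient space and in the nonnegative
   orthant have the same traces on S. *)
definition near_zero :: "'a::{topological_space, zero} set \<Rightarrow> 'a set set set" where
  "near_zero S = {p \<in> ultrafilters S. \<forall>U. open U \<and> 0 \<in> U \<longrightarrow> U \<inter> S \<in> p}"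

definition two_sided_ideal :: "('b \<Rightarrow> 'b \<Rightarrow> 'b) \<Rightarrow> 'b set \<Rightarrow> 'b set \<Rightarrow> bool" where
  "two_sided_ideal f T I \<longleftrightarrow>
     I \<noteq> {} \<and> I \<subseteq> T \<and> (\<forall>x\<in>T. \<forall>y\<in>I. f x y \<in> I \<and> f y x \<in> I)"

(* Least with respect to inclusion; every compact right topological semigroup has such an ideal. *)
definition smallest_ideal :: "('b \<Rightarrow> 'b \<Rightarrow> 'b) \<Rightarrow> 'b set \<Rightarrow> 'b set" where
  "smallest_ideal f T = (LEAST I. two_sided_ideal f T I)"

definition central_near_zero ::
    "'a::{topological_space, monoid_add} set \<Rightarrow> 'a set \<Rightarrow> bool" where
  "central_near_zero S C \<longleftrightarrow>
     (\<exists>p \<in> smallest_ideal (ultrafilter_add S) (near_zero S).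
        ultrafilter_add S p p = p \<and> C \<in> p)"

definition cart_power :: "'a set \<Rightarrow> ('a ^ 'n) set" where
  "cart_power S = {x. \<forall>i. x $ i \<in> S}"

end

theory Submission
  imports Defs
begin

text \<open>
  Let \<open>p\<close> be a minimal idempotent of \<open>0\<^sub>S\<^sup>*\<close> containing \<open>C\<close>, and let \<open>\<phi>\<^sub>i\<close> be the homomorphism from the
  ultrafilters near zero on \<open>S\<^sup>v\<close> to those on \<open>S\<close> induced by the \<open>i\<close>-th row of \<open>A\<close>. Applying the
  hypothesis to the members of \<open>p\<close> cut down to small intervals yields, by compactness, some \<open>r\<close> near
  zero with \<open>\<phi>\<^sub>i r = p\<close> for all \<open>i\<close>. Pick a minimal left ideal \<open>L\<close> inside the left ideal generated by
  \<open>r\<close> and an idempotent \<open>e\<close> of \<open>L\<close>. Then \<open>\<phi>\<^sub>i e\<close> lies in the minimal left ideal of \<open>p\<close>, so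
  \<open>p + \<phi>\<^sub>i e = p\<close> and \<open>r + e\<close> is an element of \<open>L\<close> that all \<open>\<phi>\<^sub>i\<close> map to \<open>p\<close>. Such elements form a
  closed subsemigroup of \<open>L\<close>, and any idempotent \<open>q\<close> in it witnesses the conclusion. This avoids
  computing the smallest ideal of the product of \<open>u\<close> copies of \<open>0\<^sub>S\<^sup>*\<close>.
\<close>

section \<open>Compact right topological semigroups\<close>

text \<open>Zorn's lemma is applied to complements, which turns minimal into maximal. A finite
  nonempty subfamily of a chain contains its own intersection, so a chain of nonempty closed sets
  has the finite intersection property and compactness makes its intersection nonempty. Users
  therefore verify \<open>chain\<close> with \<open>\<Inter>\<C> \<noteq> {}\<close> already
  given.\<close>

lemma compact_space_obtains_minimal_closedin:
  assumes X: "compact_space X" and A: "\<A> \<noteq> {}"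
    and closed: "\<And>F. F \<in> \<A> \<Longrightarrow> closedin X F \<and> F \<noteq> {}"
    and chain: "\<And>\<C>. \<C> \<noteq> {} \<Longrightarrow> \<C> \<subseteq> \<A> \<Longrightarrow> \<Inter>\<C> \<noteq> {} \<Longrightarrow> \<Inter>\<C> \<in> \<A>"
  obtains M where "M \<in> \<A>" "\<And>F. F \<in> \<A> \<Longrightarrow> F \<subseteq> M \<Longrightarrow> F = M"
proof -
  have "\<exists>M\<in>uminus ` \<A>. \<forall>F\<in>uminus ` \<A>. M \<subseteq> F \<longrightarrow> F = M"
  proof (rule subset_Zorn_nonempty)
    show "uminus ` \<A> \<noteq> {}" using A by simp
  next
    fix \<D> assume D: "\<D> \<noteq> {}" "subset.chain (uminus ` \<A>) \<D>"
    define \<C> where "\<C> = uminus ` \<D>"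
    have C: "\<C> \<noteq> {}" "\<C> \<subseteq> \<A>" "subset.chain \<A> \<C>"
      using D by (auto simp: \<C>_def subset_chain_def)
    have "\<Inter>\<C> \<noteq> {}"
    proof -
      have "\<Inter>\<F> \<noteq> {}" if \<F>: "finite \<F>" "\<F> \<subseteq> \<C>" for \<F>
      proof (cases "\<F> = {}")
        case False
        have "subset.chain \<A> \<F>"
          using C \<F> by (auto simp: subset_chain_def)
        then have "\<Inter>\<F> \<in> \<F>"
          using Inter_in_chain \<F>(1) False by blast
        then show ?thesis using closed C \<F> by blast
      qed simp
      moreover have "\<forall>F\<in>\<C>. closedin X F" using closed C by blast
      ultimately show ?thesis
        using X unfolding compact_space_fip by simp
    qed
    then have "\<Inter>\<C> \<in> \<A>" using chain C by blast
    moreover have "\<Union>\<D> = - \<Inter>\<C>" by (auto simp: \<C>_def)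
    ultimately show "\<Union>\<D> \<in> uminus ` \<A>" by blast
  qed
  then obtain M where "M \<in> \<A>" "\<forall>F\<in>\<A>. - M \<subseteq> - F \<longrightarrow> - F = - M" by auto
  then show thesis using that by (metis Compl_subset_Compl_iff compl_eq_compl_iff)
qed

text \<open>The set below is the union of the minimal left ideals; only its nonemptiness needs compactness.\<close>
lemma smallest_ideal_eq:
  assumes closed: "\<And>x y. x \<in> T \<Longrightarrow> y \<in> T \<Longrightarrow> f x y \<in> T"
    and assoc: "\<And>x y z. x \<in> T \<Longrightarrow> y \<in> T \<Longrightarrow> z \<in> T \<Longrightarrow> f (f x y) z = f x (f y z)"
    and nonempty: "{x \<in> T. \<forall>y\<in>T. \<exists>z\<in>T. x = f z (f y x)} \<noteq> {}" (is "?K \<noteq> {}")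
  shows "smallest_ideal f T = ?K"
  unfolding smallest_ideal_def
proof (rule Least_equality)
  show "two_sided_ideal f T ?K"
    unfolding two_sided_ideal_def
  proof (intro conjI ballI)
    fix w x assume w: "w \<in> T" and x: "x \<in> ?K"
    have "\<exists>z\<in>T. f w x = f z (f y (f w x))" if y: "y \<in> T" for y
    proof -
      \<comment> \<open>The defining property of \<open>x\<close> is used at the product
        \<open>f y w\<close>, so that \<open>f w x\<close> reappears inside the right-hand
        side.\<close>
      obtain z where z: "z \<in> T" "x = f z (f (f y w) x)"
        using x y w closed by blast
      then have "f w x = f (f w z) (f y (f w x))"
        using x y w closed assoc by (metis (no_types, lifting) mem_Collect_eq)
      then show ?thesis using z w closed by blast
    qed
    then show "f w x \<in> ?K" using w x closed by blast
    have "\<exists>z\<in>T. f x w = f z (f y (f x w))" if y: "y \<in> T" for y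
    proof -
      obtain z where z: "z \<in> T" "x = f z (f y x)"
        using x y by blast
      then have "f x w = f z (f y (f x w))"
        using x y w closed assoc by (metis (no_types, lifting) mem_Collect_eq)
      then show ?thesis using z by blast
    qed
    then show "f x w \<in> ?K" using w x closed by blast
  qed (use nonempty in auto)
next
  fix I assume I: "two_sided_ideal f T I"
  then obtain y where y: "y \<in> I" "y \<in> T" by (auto simp: two_sided_ideal_def)
  show "?K \<subseteq> I"
  proof
    fix x assume x: "x \<in> ?K"
    then obtain z where "z \<in> T" "x = f z (f y x)" using y by blast
    then show "x \<in> I" using I x y unfolding two_sided_ideal_def
      by (metis (no_types, lifting) mem_Collect_eq)
  qed
qed

text \<open>Continuity is asked for in the left argument, the side on which addition of ultrafilters
  is continuous in the convention of \<open>ultrafilter_add\<close>.\<close>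

locale compact_right_topological_semigroup =
  fixes X :: "'b topology" and f :: "'b \<Rightarrow> 'b \<Rightarrow> 'b" (infixl "\<cdot>" 70)
  assumes closed: "x \<in> topspace X \<Longrightarrow> y \<in> topspace X \<Longrightarrow> x \<cdot> y \<in> topspace X"
    and assoc: "x \<in> topspace X \<Longrightarrow> y \<in> topspace X \<Longrightarrow> z \<in> topspace X \<Longrightarrow>
      x \<cdot> y \<cdot> z = x \<cdot> (y \<cdot> z)"
    and compact: "compact_space X"
    and Hausdorff: "Hausdorff_space X"
    and continuous: "y \<in> topspace X \<Longrightarrow> continuous_map X X (\<lambda>x. x \<cdot> y)"
begin

lemma closedin_right_translate:
  assumes "closedin X F" "y \<in> topspace X"
  shows "closedin X ((\<lambda>x. x \<cdot> y) ` F)"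
  using continuous_imp_closed_map[OF continuous[OF assms(2)] compact Hausdorff] assms(1)
  by (simp add: closed_map_def)

lemma closedin_right_fiber:
  assumes "x \<in> topspace X" "y \<in> topspace X"
  shows "closedin X {z \<in> topspace X. z \<cdot> x = y}"
  using closedin_continuous_map_preimage[OF continuous[OF assms(1)]
      closedin_Hausdorff_singleton[OF Hausdorff assms(2)]] by simp

text \<open>The Ellis-Numakura lemma. In a minimal closed subsemigroup \<open>B\<close>, the right
  translate of \<open>B\<close> by any \<open>x\<close> in \<open>B\<close> is again a closed
  subsemigroup, hence all of \<open>B\<close>. So \<open>x\<close> has a left identity in
  \<open>B\<close>; its left identities in \<open>B\<close> form a closed subsemigroup, which is
  again \<open>B\<close> and thus contains \<open>x\<close>.\<close>

lemma ex_idempotent: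
  assumes A: "closedin X A" "A \<noteq> {}" "\<And>x y. x \<in> A \<Longrightarrow> y \<in> A \<Longrightarrow> x \<cdot> y \<in> A"
  shows "\<exists>e\<in>A. e \<cdot> e = e"
proof -
  let ?\<A> = "{B. closedin X B \<and> B \<noteq> {} \<and> B \<subseteq> A \<and> (\<forall>x\<in>B. \<forall>y\<in>B. x \<cdot> y \<in> B)}"
  obtain B where B: "B \<in> ?\<A>" and min: "\<And>F. F \<in> ?\<A> \<Longrightarrow> F \<subseteq> B \<Longrightarrow> F = B"
  proof (rule compact_space_obtains_minimal_closedin[OF compact, of ?\<A>])
    show "\<Inter>\<C> \<in> ?\<A>" if "\<C> \<noteq> {}" "\<C> \<subseteq> ?\<A>" "\<Inter>\<C> \<noteq> {}" for \<C>
    proof -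
      have "closedin X (\<Inter>\<C>)" using that by (intro closedin_Inter) auto
      then show ?thesis using that by blast
    qed
  qed (use A in auto)
  have top: "B \<subseteq> topspace X" using B closedin_subset by blast
  obtain x where x: "x \<in> B" using B by blast
  have "(\<lambda>y. y \<cdot> x) ` B \<in> ?\<A>"
  proof -
    have "y \<cdot> x \<cdot> (z \<cdot> x) = (y \<cdot> x \<cdot> z) \<cdot> x" "y \<cdot> x \<cdot> z \<in> B" if "y \<in> B" "z \<in> B" for y z
      using that x B top by (auto simp: assoc closed subset_iff)
    then show ?thesis using B x top closedin_right_translate by auto
  qed
  moreover have "(\<lambda>y. y \<cdot> x) ` B \<subseteq> B" using B x by blast
  ultimately have "(\<lambda>y. y \<cdot> x) ` B = B" using min by blast
  then have "x \<in> (\<lambda>y. y \<cdot> x) ` B" using x by simp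
  then obtain y where y: "y \<in> B" "y \<cdot> x = x" by auto
  let ?C = "B \<inter> {z \<in> topspace X. z \<cdot> x = x}"
  have "closedin X ?C" using B x top by (intro closedin_Int closedin_right_fiber) auto
  moreover have "\<forall>u\<in>?C. \<forall>v\<in>?C. u \<cdot> v \<in> ?C"
    using B x top by (auto simp: assoc closed)
  ultimately have "?C \<in> ?\<A>" using y B top by blast
  then have "?C = B" using min by blast
  then show ?thesis using x B by blast
qed

text \<open>The last property is minimality in pointwise form, matching the condition in
  \<open>smallest_ideal_eq\<close>. The left multiples of \<open>y \<cdot> x\<close> form a left
  ideal inside \<open>L\<close> that is closed by compactness, so minimality among closed left
  ideals makes it all of \<open>L\<close>.\<close>

lemma obtains_minimal_left_ideal:
  assumes J: "closedin X J" "J \<noteq> {}" "\<And>x y. x \<in> topspace X \<Longrightarrow> y \<in> J \<Longrightarrow> x \<cdot> y \<in> J"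
  obtains L where "closedin X L" "L \<noteq> {}" "L \<subseteq> J"
    "\<And>x y. x \<in> topspace X \<Longrightarrow> y \<in> L \<Longrightarrow> x \<cdot> y \<in> L"
    "\<And>x y. x \<in> L \<Longrightarrow> y \<in> topspace X \<Longrightarrow> \<exists>z\<in>topspace X. x = z \<cdot> (y \<cdot> x)"
proof -
  let ?\<A> = "{B. closedin X B \<and> B \<noteq> {} \<and> B \<subseteq> J \<and> (\<forall>x\<in>topspace X. \<forall>y\<in>B. x \<cdot> y \<in> B)}"
  obtain L where L: "L \<in> ?\<A>" and min: "\<And>F. F \<in> ?\<A> \<Longrightarrow> F \<subseteq> L \<Longrightarrow> F = L"
  proof (rule compact_space_obtains_minimal_closedin[OF compact, of ?\<A>])
    show "\<Inter>\<C> \<in> ?\<A>" if "\<C> \<noteq> {}" "\<C> \<subseteq> ?\<A>" "\<Inter>\<C> \<noteq> {}" for \<C>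
    proof -
      have "closedin X (\<Inter>\<C>)" using that by (intro closedin_Inter) auto
      then show ?thesis using that by blast
    qed
  qed (use J in auto)
  have top: "L \<subseteq> topspace X" using L closedin_subset by blast
  have "\<exists>z\<in>topspace X. x = z \<cdot> (y \<cdot> x)" if x: "x \<in> L" and y: "y \<in> topspace X" for x y
  proof -
    let ?F = "(\<lambda>z. z \<cdot> (y \<cdot> x)) ` topspace X"
    have yx: "y \<cdot> x \<in> L" "y \<cdot> x \<in> topspace X" using L x y top by auto
    have sub: "?F \<subseteq> L" using L yx by blast
    have "w \<cdot> v \<in> ?F" if w: "w \<in> topspace X" and v: "v \<in> ?F" for w v
    proof -
      obtain z where z: "z \<in> topspace X" "v = z \<cdot> (y \<cdot> x)" using v by auto
      then have "w \<cdot> v = (w \<cdot> z) \<cdot> (y \<cdot> x)" using assoc yx w by simp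
      then show ?thesis using z w closed by blast
    qed
    moreover have "closedin X ?F" using closedin_right_translate[OF closedin_topspace yx(2)] .
    moreover have "?F \<noteq> {}" using y by blast
    ultimately have "?F \<in> ?\<A>" using sub L by blast
    then have "?F = L" using min sub by blast
    then have "x \<in> ?F" using x by simp
    then show ?thesis by blast
  qed
  then show thesis using that L by blast
qed

lemma smallest_ideal_topspace:
  assumes "topspace X \<noteq> {}"
  shows "smallest_ideal f (topspace X)
    = {x \<in> topspace X. \<forall>y\<in>topspace X. \<exists>z\<in>topspace X. x = z \<cdot> (y \<cdot> x)}"
proof (rule smallest_ideal_eq)
  obtain L where L: "closedin X L" "L \<noteq> {}"
    "\<And>x y. x \<in> L \<Longrightarrow> y \<in> topspace X \<Longrightarrow> \<exists>z\<in>topspace X. x = z \<cdot> (y \<cdot> x)"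
    by (rule obtains_minimal_left_ideal[of "topspace X"]) (use assms closed in auto)
  then obtain x where "x \<in> L" "x \<in> topspace X" using closedin_subset by blast
  then show "{x \<in> topspace X. \<forall>y\<in>topspace X. \<exists>z\<in>topspace X. x = z \<cdot> (y \<cdot> x)} \<noteq> {}"
    using L(3) by auto
qed (use closed assoc in auto)

end

text \<open>Any common preimage \<open>r\<close> of \<open>p\<close> can be upgraded to a minimal
  idempotent one. Choosing \<open>L\<close> among the left multiples of \<open>r\<close> makes the
  images of its elements left multiples of \<open>p\<close>, to which the minimality of
  \<open>p\<close> applies.\<close>

lemma minimal_idempotent_lift:
  assumes M: "compact_right_topological_semigroup X f"
    and T: "compact_right_topological_semigroup Y g"
    and cont: "\<And>i. i \<in> I \<Longrightarrow> continuous_map X Y (\<phi> i)"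
    and hom: "\<And>i x y. i \<in> I \<Longrightarrow> x \<in> topspace X \<Longrightarrow> y \<in> topspace X \<Longrightarrow>
      \<phi> i (f x y) = g (\<phi> i x) (\<phi> i y)"
    and p: "p \<in> smallest_ideal g (topspace Y)" "g p p = p"
    and r: "r \<in> topspace X" "\<And>i. i \<in> I \<Longrightarrow> \<phi> i r = p"
    and Y: "p \<in> topspace Y"
  shows "\<exists>q\<in>smallest_ideal f (topspace X). f q q = q \<and> (\<forall>i\<in>I. \<phi> i q = p)"
proof -
  interpret M: compact_right_topological_semigroup X f by (rule M)
  interpret T: compact_right_topological_semigroup Y g by (rule T)
  have phi_top: "\<phi> i x \<in> topspace Y" if "i \<in> I" "x \<in> topspace X" for i x
    using cont[OF that(1)] that(2) by (auto simp: continuous_map_def)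
  have p_min: "\<exists>z\<in>topspace Y. p = g z (g y p)" if "y \<in> topspace Y" for y
  proof -
    have "topspace Y \<noteq> {}" using Y by blast
    then show ?thesis using p(1) T.smallest_ideal_topspace that by simp
  qed
  let ?J = "(\<lambda>x. f x r) ` topspace X"
  obtain L where L: "closedin X L" "L \<noteq> {}" "L \<subseteq> ?J"
    "\<And>x y. x \<in> topspace X \<Longrightarrow> y \<in> L \<Longrightarrow> f x y \<in> L"
    "\<And>x y. x \<in> L \<Longrightarrow> y \<in> topspace X \<Longrightarrow> \<exists>z\<in>topspace X. x = f z (f y x)"
  proof (rule M.obtains_minimal_left_ideal)
    show "closedin X ?J" by (rule M.closedin_right_translate) (use r in auto)
    show "?J \<noteq> {}" using r by blast
    show "f x y \<in> ?J" if x: "x \<in> topspace X" and y: "y \<in> ?J" for x y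
    proof -
      obtain z where z: "z \<in> topspace X" "y = f z r" using y by auto
      then have "f x y = f (f x z) r" using M.assoc x r(1) by simp
      then show ?thesis using z x M.closed by blast
    qed
  qed blast
  have top: "L \<subseteq> topspace X" using L(1) closedin_subset by blast
  obtain e where e: "e \<in> L" "f e e = e"
    using M.ex_idempotent[OF L(1,2)] L(4) top by blast
  obtain m where m: "m \<in> topspace X" "e = f m r" using e L(3) by blast
  have pe: "\<phi> i (f r e) = p" if i: "i \<in> I" for i
  proof -
    have "\<phi> i e = g (\<phi> i m) p" using hom[OF i m(1) r(1)] m r(2)[OF i] by simp
    \<comment> \<open>Minimality of \<open>p\<close> at \<open>\<phi> i m\<close> recovers
      \<open>p\<close> as a left multiple of \<open>\<phi> i e\<close>. Since
      \<open>\<phi> i e\<close> is idempotent, it is then a right identity for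
      \<open>p\<close>.\<close>
    then obtain z where z: "z \<in> topspace Y" "p = g z (\<phi> i e)"
      using p_min phi_top[OF i m(1)] by metis
    have ei: "\<phi> i e \<in> topspace Y" "g (\<phi> i e) (\<phi> i e) = \<phi> i e"
      using phi_top[OF i] hom[OF i, of e e] e top by auto
    have "g p (\<phi> i e) = p" using T.assoc[OF z(1) ei(1) ei(1)] ei(2) z(2) by simp
    then show ?thesis using hom[OF i r(1)] e top r(2)[OF i] by auto
  qed
  define N where "N = {q \<in> topspace X. \<forall>i\<in>I. \<phi> i q = p}"
  \<comment> \<open>An intersection over an empty \<open>I\<close> would be the whole type rather
    than \<open>topspace X\<close>, hence the case split.\<close>
  have "closedin X N"
  proof (cases "I = {}")
    case False
    have "N = (\<Inter>i\<in>I. {q \<in> topspace X. \<phi> i q \<in> {p}})" using False by (auto simp: N_def)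
    also have "closedin X \<dots>"
      by (rule closedin_Inter)
        (use False cont closedin_continuous_map_preimage
          closedin_Hausdorff_singleton[OF T.Hausdorff Y] in blast)+
    finally show ?thesis .
  qed (simp add: N_def)
  then have closed: "closedin X (L \<inter> N)" using L(1) by blast
  \<comment> \<open>This element shows that \<open>L \<inter> N\<close> is nonempty. The
    intersection is a semigroup because \<open>L\<close> is a left ideal and \<open>p\<close> is
    idempotent.\<close>
  have "f r e \<in> L \<inter> N" using pe e r L(4) top by (auto simp: N_def)
  then have "\<exists>q\<in>L \<inter> N. f q q = q"
    using M.ex_idempotent[OF closed] L(4) top p M.closed hom by (auto simp: N_def)
  then obtain q where q: "q \<in> L" "q \<in> N" "f q q = q" by blast
  then have "q \<in> smallest_ideal f (topspace X)"
    using M.smallest_ideal_topspace r(1) L(5) top by blast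
  then show ?thesis using q by (auto simp: N_def)
qed

section \<open>The Stone space of ultrafilters\<close>

text \<open>On subsets of \<open>S\<close>, membership in an ultrafilter is a Boolean homomorphism.
  Each clause involves at most three sets, so it cuts out a closed subset of the product space, and
  it transfers along operations commuting with intersection and complement.\<close>

lemma ultrafilters_iff:
  "p \<in> ultrafilters S \<longleftrightarrow> p \<subseteq> Pow S \<and>
    (\<forall>A B. A \<subseteq> S \<longrightarrow> B \<subseteq> S \<longrightarrow> (A \<inter> B \<in> p \<longleftrightarrow> A \<in> p \<and> B \<in> p)) \<and>
    (\<forall>A. A \<subseteq> S \<longrightarrow> (S - A \<in> p \<longleftrightarrow> A \<notin> p))" (is "_ \<longleftrightarrow> ?R")
proof
  assume "p \<in> ultrafilters S"
  then have p: "p \<subseteq> Pow S" "{} \<notin> p" "\<And>A B. A \<in> p \<Longrightarrow> B \<in> p \<Longrightarrow> A \<inter> B \<in> p"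
    "\<And>A B. A \<in> p \<Longrightarrow> A \<subseteq> B \<Longrightarrow> B \<subseteq> S \<Longrightarrow> B \<in> p" "\<And>A. A \<subseteq> S \<Longrightarrow> A \<in> p \<or> S - A \<in> p"
    unfolding ultrafilters_def ultrafilter_on_def by auto
  have "A \<inter> B \<in> p \<longleftrightarrow> A \<in> p \<and> B \<in> p" if "A \<subseteq> S" "B \<subseteq> S" for A B
    using that p(3,4) by (meson inf.cobounded1 inf.cobounded2)
  moreover have "S - A \<in> p \<longleftrightarrow> A \<notin> p" if "A \<subseteq> S" for A
    using that p(2,5) p(3)[of A "S - A"] by auto
  ultimately show ?R using p(1) by simp
next
  assume R: ?R
  \<comment> \<open>If \<open>{}\<close> were a member, then so would be \<open>S\<close>, because
    \<open>{} \<inter> S = {}\<close>; this contradicts the complement clause.\<close>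
  then have S: "S \<in> p \<longleftrightarrow> {} \<notin> p" by (metis Diff_empty empty_subsetI)
  moreover have "{} \<in> p \<Longrightarrow> S \<in> p" using R by (metis Int_empty_right empty_subsetI order_refl)
  ultimately have "S \<in> p" "{} \<notin> p" by auto
  moreover have "Y \<in> p" if "X \<in> p" "X \<subseteq> Y" "Y \<subseteq> S" for X Y
  proof -
    have "X \<inter> Y \<in> p" using that by (simp add: inf.absorb1)
    then show ?thesis using R that by (meson dual_order.trans)
  qed
  moreover have "A \<inter> B \<in> p" if "A \<in> p" "B \<in> p" for A B
    using R that by (metis PowD subsetD)
  moreover have "A \<in> p \<or> S - A \<in> p" if "A \<subseteq> S" for A
    using R that by blast
  ultimately show "p \<in> ultrafilters S"
    unfolding ultrafilters_def ultrafilter_on_def using R by auto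
qed

lemma ultrafilters_subset: "p \<in> ultrafilters S \<Longrightarrow> A \<in> p \<Longrightarrow> A \<subseteq> S"
  by (auto simp: ultrafilters_iff)

lemma ultrafilters_Int_iff:
  "p \<in> ultrafilters S \<Longrightarrow> A \<subseteq> S \<Longrightarrow> B \<subseteq> S \<Longrightarrow> A \<inter> B \<in> p \<longleftrightarrow> A \<in> p \<and> B \<in> p"
  by (simp add: ultrafilters_iff)

lemma ultrafilters_Diff_iff: "p \<in> ultrafilters S \<Longrightarrow> A \<subseteq> S \<Longrightarrow> S - A \<in> p \<longleftrightarrow> A \<notin> p"
  by (simp add: ultrafilters_iff)

lemma ultrafilters_mono:
  "p \<in> ultrafilters S \<Longrightarrow> A \<in> p \<Longrightarrow> A \<subseteq> B \<Longrightarrow> B \<subseteq> S \<Longrightarrow> B \<in> p"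
  unfolding ultrafilters_def ultrafilter_on_def by blast

lemma ultrafilters_nonempty: "p \<in> ultrafilters S \<Longrightarrow> A \<in> p \<Longrightarrow> A \<noteq> {}"
  unfolding ultrafilters_def ultrafilter_on_def by blast

lemma ultrafilters_eqI:
  assumes p: "p \<in> ultrafilters S" and q: "q \<in> ultrafilters S" and pq: "p \<subseteq> q"
  shows "p = q"
proof (rule equalityI[OF pq], rule subsetI)
  fix A assume A: "A \<in> q"
  have sub: "A \<subseteq> S" by (rule ultrafilters_subset[OF q A])
  then have "S - A \<notin> q" using A by (simp add: ultrafilters_Diff_iff[OF q])
  then have "S - A \<notin> p" using pq by auto
  then show "A \<in> p" using sub by (simp add: ultrafilters_Diff_iff[OF p])
qed

lemma principal_ultrafilter: "x \<in> S \<Longrightarrow> {A. A \<subseteq> S \<and> x \<in> A} \<in> ultrafilters S"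
  by (auto simp: ultrafilters_iff)

text \<open>An ultrafilter is identified with its indicator function, so the sets
  \<open>{p \<in> ultrafilters S. A \<in> p}\<close> are clopen and generate the topology.
  Coordinates \<open>A\<close> outside \<open>Pow S\<close> are constantly false on
  ultrafilters.\<close>

definition stone_topology :: "'a set \<Rightarrow> 'a set set topology" where
  "stone_topology S = pullback_topology (ultrafilters S) (\<lambda>p A. A \<in> p)
     (product_topology (\<lambda>_. discrete_topology UNIV) UNIV)"

lemma topspace_stone_topology [simp]: "topspace (stone_topology S) = ultrafilters S"
  by (simp add: stone_topology_def topspace_pullback_topology)

lemma continuous_map_mem_stone_topology:
  "continuous_map (stone_topology S) (discrete_topology UNIV) (\<lambda>p. A \<in> p)"
proof -
  have "continuous_map (product_topology (\<lambda>_. discrete_topology (UNIV :: bool set)) UNIV)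
      (discrete_topology UNIV) (\<lambda>\<phi>. \<phi> A)"
    by (rule continuous_map_product_projection) simp
  from continuous_map_pullback[OF this, of "ultrafilters S" "\<lambda>p A. A \<in> p"]
  show ?thesis by (simp add: stone_topology_def o_def)
qed

lemma continuous_map_into_stone_topology:
  assumes "\<And>x. x \<in> topspace X \<Longrightarrow> h x \<in> ultrafilters S"
    and "\<And>A. continuous_map X (discrete_topology UNIV) (\<lambda>x. A \<in> h x)"
  shows "continuous_map X (stone_topology S) h"
  unfolding stone_topology_def
proof (rule continuous_map_pullback')
  show "continuous_map X (product_topology (\<lambda>_. discrete_topology UNIV) UNIV)
      ((\<lambda>p A. A \<in> p) \<circ> h)"
    using assms(2) by (simp add: continuous_map_componentwise_UNIV)
qed (use assms(1) in auto)

lemma closedin_mem_stone_topology: "closedin (stone_topology S) {p \<in> ultrafilters S. A \<in> p}"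
  using closedin_continuous_map_preimage[OF continuous_map_mem_stone_topology, of "{True}" S A]
  by simp

lemma Hausdorff_space_stone_topology: "Hausdorff_space (stone_topology S)"
proof -
  have open_mem: "openin (stone_topology S) {p \<in> ultrafilters S. (A \<in> p) = b}" for A b
    using openin_continuous_map_preimage[OF continuous_map_mem_stone_topology, of "{b}" S A]
    by simp
  show ?thesis
    unfolding Hausdorff_space_def
  proof (intro allI impI)
    fix p q :: "'a set set"
    assume pq: "p \<in> topspace (stone_topology S) \<and> q \<in> topspace (stone_topology S) \<and> p \<noteq> q"
    then obtain A where A: "(A \<in> p) \<noteq> (A \<in> q)" by blast
    show "\<exists>U V. openin (stone_topology S) U \<and> openin (stone_topology S) V \<and>
        p \<in> U \<and> q \<in> V \<and> disjnt U V"
      by (rule exI[of _ "{r \<in> ultrafilters S. (A \<in> r) = (A \<in> p)}"],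
          rule exI[of _ "{r \<in> ultrafilters S. (A \<in> r) = (A \<in> q)}"])
        (use open_mem pq A in \<open>auto simp: disjnt_def\<close>)
  qed
qed

text \<open>A product of two discrete spaces is discrete, so \<open>h\<close> is continuous on it.
  Applied to coordinates, this makes Boolean conditions on them clopen.\<close>

lemma continuous_map_discrete_binop:
  assumes "continuous_map X (discrete_topology UNIV) a" "continuous_map X (discrete_topology UNIV) b"
  shows "continuous_map X (discrete_topology UNIV) (\<lambda>x. h (a x) (b x))"
proof -
  have "continuous_map X (discrete_topology UNIV) (\<lambda>x. (a x, b x))"
    using continuous_map_pairedI[OF assms]
    by (simp flip: prod_topology_discrete_topology UNIV_Times_UNIV)
  from continuous_map_compose[OF this, of "discrete_topology UNIV" "\<lambda>(u, v). h u v"]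
  show ?thesis by (simp add: o_def)
qed

text \<open>The indicator functions of ultrafilters form a closed subset of a power of the two-point
  space, which is compact by Tychonoff's theorem; \<open>Collect\<close> carries this subset
  continuously onto the ultrafilters.\<close>

lemma compact_space_stone_topology: "compact_space (stone_topology S)"
proof -
  let ?Z = "product_topology (\<lambda>_. discrete_topology (UNIV :: bool set)) (UNIV :: 'a set set)"
  let ?U = "{\<phi>. Collect \<phi> \<in> ultrafilters S}"
  have proj: "continuous_map ?Z (discrete_topology UNIV) (\<lambda>\<phi>. \<phi> A)" for A
    by (rule continuous_map_product_projection) simp
  have cl: "closedin ?Z {\<phi>. h (\<phi> A) (\<phi> B)}" for h A B
    using closedin_continuous_map_preimage[OF continuous_map_discrete_binop[OF proj proj, of h A B],
        of "{True}"] by simp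
  have cl3: "closedin ?Z {\<phi>. \<phi> (A \<inter> B) = (\<phi> A \<and> \<phi> B)}" for A B
    using closedin_continuous_map_preimage[OF continuous_map_discrete_binop[OF proj
        continuous_map_discrete_binop[OF proj proj], of "(=)" "A \<inter> B" "(\<and>)" A B],
        of "{True}"] by simp
  have U: "?U = (\<Inter>A\<in>-Pow S. {\<phi>. \<not> \<phi> A}) \<inter> (\<Inter>A\<in>Pow S. {\<phi>. \<phi> (S - A) = (\<not> \<phi> A)})
      \<inter> (\<Inter>A\<in>Pow S. \<Inter>B\<in>Pow S. {\<phi>. \<phi> (A \<inter> B) = (\<phi> A \<and> \<phi> B)})"
    by (auto simp: ultrafilters_iff)
  \<comment> \<open>If \<open>S\<close> is the whole type, no set lies outside \<open>Pow S\<close>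
    and the intersection is over an empty family.\<close>
  have "closedin ?Z (\<Inter>A\<in>-Pow S. {\<phi>. \<not> \<phi> A})"
  proof (cases "- Pow S = {}")
    case False
    then show ?thesis using cl[of "\<lambda>a b. \<not> a"] by (intro closedin_Inter) auto
  next
    case True
    show ?thesis using closedin_topspace[of ?Z] unfolding True by simp
  qed
  moreover have "closedin ?Z (\<Inter>A\<in>Pow S. {\<phi>. \<phi> (S - A) = (\<not> \<phi> A)})"
    using cl[of "\<lambda>a b. a = (\<not> b)"] by (intro closedin_Inter) auto
  moreover have "closedin ?Z (\<Inter>A\<in>Pow S. \<Inter>B\<in>Pow S. {\<phi>. \<phi> (A \<inter> B) = (\<phi> A \<and> \<phi> B)})"
  proof (rule closedin_Inter)
    fix K assume "K \<in> (\<lambda>A. \<Inter>B\<in>Pow S. {\<phi>. \<phi> (A \<inter> B) = (\<phi> A \<and> \<phi> B)}) ` Pow S"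
    then obtain A where "K = (\<Inter>B\<in>Pow S. {\<phi>. \<phi> (A \<inter> B) = (\<phi> A \<and> \<phi> B)})" by blast
    then show "closedin ?Z K" using cl3 by (auto intro!: closedin_Inter)
  qed auto
  ultimately have "closedin ?Z ?U" unfolding U by (intro closedin_Int)
  then have "compactin ?Z ?U"
    by (intro closedin_compact_space) (auto simp: compact_space_product_topology compact_space_discrete_topology)
  then have "compactin (subtopology ?Z ?U) ?U" by (simp add: compactin_subtopology)
  moreover have "continuous_map (subtopology ?Z ?U) (stone_topology S) Collect"
    by (rule continuous_map_into_stone_topology)
      (use continuous_map_from_subtopology[OF proj] in auto)
  ultimately have "compactin (stone_topology S) (Collect ` ?U)" by (rule image_compactin)
  moreover have "Collect ` ?U = ultrafilters S"
  proof
    show "ultrafilters S \<subseteq> Collect ` ?U"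
    proof
      fix p assume "p \<in> ultrafilters S"
      then show "p \<in> Collect ` ?U" by (intro image_eqI[of _ _ "\<lambda>A. A \<in> p"]) auto
    qed
  qed auto
  ultimately show ?thesis by (simp add: compact_space_def)
qed

text \<open>Extension of a filter base, read off from compactness: a point in the intersection of
  finitely many members of \<open>\<G>\<close> gives a principal ultrafilter containing them
  all.\<close>

lemma ex_ultrafilter:
  assumes "\<G> \<subseteq> Pow S" "\<G> \<noteq> {}" "{} \<notin> \<G>" and Int: "\<And>A B. A \<in> \<G> \<Longrightarrow> B \<in> \<G> \<Longrightarrow> A \<inter> B \<in> \<G>"
  shows "\<exists>p\<in>ultrafilters S. \<G> \<subseteq> p"
proof -
  let ?c = "\<lambda>A. {p \<in> ultrafilters S. A \<in> p}"
  have "\<Inter>\<F> \<noteq> {}" if F: "finite \<F>" "\<F> \<subseteq> ?c ` \<G>" for \<F>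
  proof -
    obtain \<H> where H: "finite \<H>" "\<H> \<subseteq> \<G>" "\<F> = ?c ` \<H>"
      using finite_subset_image[OF F] by blast
    show ?thesis
    proof (cases "\<H> = {}")
      case False
      have "\<Inter>\<H> \<in> \<G>"
        using H(1) False H(2)
      proof (induction rule: finite_ne_induct)
        case (insert A \<H>)
        then show ?case using Int by simp
      qed simp
      then obtain x where x: "x \<in> \<Inter>\<H>" using assms(3) by (metis all_not_in_conv)
      have HS: "\<And>A. A \<in> \<H> \<Longrightarrow> A \<subseteq> S" using H(2) assms(1) by blast
      then have "x \<in> S" using False x by blast
      then have "{A. A \<subseteq> S \<and> x \<in> A} \<in> \<Inter>\<F>"
        using principal_ultrafilter x HS by (auto simp: H(3))
      then show ?thesis by blast
    qed (simp add: H)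
  qed
  moreover have "\<forall>C\<in>?c ` \<G>. closedin (stone_topology S) C"
    using closedin_mem_stone_topology by blast
  ultimately have "\<Inter> (?c ` \<G>) \<noteq> {}"
    using compact_space_stone_topology[of S] unfolding compact_space_fip by simp
  then show ?thesis using assms(2) by blast
qed

section \<open>Addition of ultrafilters near zero\<close>

lemma ultrafilter_add_mem_iff:
  "A \<in> ultrafilter_add S p q \<longleftrightarrow> A \<subseteq> S \<and> {s \<in> S. left_translate S s A \<in> q} \<in> p"
  by (simp add: ultrafilter_add_def)

text \<open>Translation commutes with intersections, and with complements in \<open>S\<close>
  because \<open>S\<close> is closed under addition; both clauses then pass through \<open>q\<close>
  and \<open>p\<close> in turn.\<close>

lemma ultrafilter_add_closed:
  assumes S: "\<And>s t. s \<in> S \<Longrightarrow> t \<in> S \<Longrightarrow> s + t \<in> S"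
    and p: "p \<in> ultrafilters S" and q: "q \<in> ultrafilters S"
  shows "ultrafilter_add S p q \<in> ultrafilters S"
  unfolding ultrafilters_iff
proof (intro conjI allI impI)
  have sub: "left_translate S s A \<subseteq> S" for s A by (auto simp: left_translate_def)
  show "ultrafilter_add S p q \<subseteq> Pow S" by (auto simp: ultrafilter_add_def)
  fix A assume A: "A \<subseteq> S"
  have "left_translate S s (S - A) = S - left_translate S s A" if "s \<in> S" for s
    using S that by (auto simp: left_translate_def)
  then have "{s \<in> S. left_translate S s (S - A) \<in> q} = S - {s \<in> S. left_translate S s A \<in> q}"
    using ultrafilters_Diff_iff[OF q sub] by auto
  then show "S - A \<in> ultrafilter_add S p q \<longleftrightarrow> A \<notin> ultrafilter_add S p q"
    using A ultrafilters_Diff_iff[OF p, of "{s \<in> S. left_translate S s A \<in> q}"]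
    by (auto simp: ultrafilter_add_mem_iff)
  fix B assume B: "B \<subseteq> S"
  have "left_translate S s (A \<inter> B) = left_translate S s A \<inter> left_translate S s B" for s
    by (auto simp: left_translate_def)
  then have "{s \<in> S. left_translate S s (A \<inter> B) \<in> q}
      = {s \<in> S. left_translate S s A \<in> q} \<inter> {s \<in> S. left_translate S s B \<in> q}"
    using ultrafilters_Int_iff[OF q sub sub] by auto
  then show "A \<inter> B \<in> ultrafilter_add S p q \<longleftrightarrow>
      A \<in> ultrafilter_add S p q \<and> B \<in> ultrafilter_add S p q"
    using A B ultrafilters_Int_iff[OF p, of "{s \<in> S. left_translate S s A \<in> q}"
        "{s \<in> S. left_translate S s B \<in> q}"]
    by (auto simp: ultrafilter_add_mem_iff)
qed

text \<open>Both sides unfold to the same iterated condition, since translating by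
  \<open>a + b\<close> amounts to translating by \<open>a\<close> and then by
  \<open>b\<close>.\<close>

lemma ultrafilter_add_assoc:
  fixes S :: "'a::semigroup_add set"
  assumes S: "\<And>s t. s \<in> S \<Longrightarrow> t \<in> S \<Longrightarrow> s + t \<in> S"
  shows "ultrafilter_add S (ultrafilter_add S p q) r = ultrafilter_add S p (ultrafilter_add S q r)"
proof -
  have "left_translate S a {s \<in> S. left_translate S s A \<in> r}
      = {b \<in> S. left_translate S b (left_translate S a A) \<in> r}" if "a \<in> S" for a A
  proof -
    have "left_translate S (a + b) A = left_translate S b (left_translate S a A)" if "b \<in> S" for b
      using S that by (auto simp: left_translate_def add.assoc)
    then show ?thesis using S that by (auto simp: left_translate_def[of S a])
  qed
  moreover have "left_translate S a A \<subseteq> S" for a A by (auto simp: left_translate_def)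
  ultimately have "{a \<in> S. left_translate S a {s \<in> S. left_translate S s A \<in> r} \<in> q}
      = {a \<in> S. left_translate S a A \<in> ultrafilter_add S q r}" for A
    by (auto simp: ultrafilter_add_mem_iff)
  then show ?thesis by (auto simp: ultrafilter_add_mem_iff)
qed

lemma near_zero_ultrafilters: "p \<in> near_zero S \<Longrightarrow> p \<in> ultrafilters S"
  by (simp add: near_zero_def)

lemma near_zero_mem: "p \<in> near_zero S \<Longrightarrow> open U \<Longrightarrow> 0 \<in> U \<Longrightarrow> U \<inter> S \<in> p"
  by (simp add: near_zero_def)

text \<open>For \<open>s\<close> in an open \<open>U\<close>, the translate of \<open>U\<close> by
  \<open>s\<close> is an open neighborhood of 0 and so its trace belongs to \<open>q\<close>; the
  set of such \<open>s\<close> in \<open>S\<close> belongs to \<open>p\<close>.\<close>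

lemma near_zero_add_closed:
  fixes S :: "'a::topological_monoid_add set"
  assumes S: "\<And>s t. s \<in> S \<Longrightarrow> t \<in> S \<Longrightarrow> s + t \<in> S"
    and p: "p \<in> near_zero S" and q: "q \<in> near_zero S"
  shows "ultrafilter_add S p q \<in> near_zero S"
  unfolding near_zero_def
proof (intro CollectI conjI allI impI)
  show "ultrafilter_add S p q \<in> ultrafilters S"
    using ultrafilter_add_closed S near_zero_ultrafilters p q by blast
  fix U :: "'a set" assume U: "open U \<and> 0 \<in> U"
  have "left_translate S s (U \<inter> S) \<in> q" if s: "s \<in> U \<inter> S" for s
  proof -
    have "open ((+) s -` U)" using U by (intro open_vimage continuous_intros) auto
    then have "((+) s -` U) \<inter> S \<in> q" using q s by (intro near_zero_mem) auto
    moreover have "((+) s -` U) \<inter> S \<subseteq> left_translate S s (U \<inter> S)"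
      using S s by (auto simp: left_translate_def)
    ultimately show ?thesis
      using ultrafilters_mono[OF near_zero_ultrafilters[OF q]] by (auto simp: left_translate_def)
  qed
  then have "U \<inter> S \<subseteq> {s \<in> S. left_translate S s (U \<inter> S) \<in> q}" by auto
  then show "U \<inter> S \<in> ultrafilter_add S p q"
    using ultrafilters_mono[OF near_zero_ultrafilters[OF p] near_zero_mem[OF p]] U
    by (auto simp: ultrafilter_add_mem_iff)
qed

lemma closedin_near_zero: "closedin (stone_topology S) (near_zero S)"
proof -
  have "near_zero S = (\<Inter>U\<in>{U. open U \<and> 0 \<in> U}. {p \<in> ultrafilters S. U \<inter> S \<in> p})"
    using open_UNIV by (auto simp: near_zero_def)
  also have "closedin (stone_topology S) \<dots>"
    using closedin_mem_stone_topology open_UNIV by (intro closedin_Inter) auto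
  finally show ?thesis .
qed

definition near_zero_topology :: "'a::{topological_space, zero} set \<Rightarrow> 'a set set topology" where
  "near_zero_topology S = subtopology (stone_topology S) (near_zero S)"

lemma topspace_near_zero_topology [simp]: "topspace (near_zero_topology S) = near_zero S"
  using near_zero_ultrafilters by (auto simp: near_zero_topology_def)

lemma near_zero_semigroup:
  fixes S :: "'a::topological_monoid_add set"
  assumes S: "\<And>s t. s \<in> S \<Longrightarrow> t \<in> S \<Longrightarrow> s + t \<in> S"
  shows "compact_right_topological_semigroup (near_zero_topology S) (ultrafilter_add S)"
proof
  show "compact_space (near_zero_topology S)"
    unfolding near_zero_topology_def
    by (intro compact_space_subtopology closedin_compact_space compact_space_stone_topology
        closedin_near_zero)
  show "Hausdorff_space (near_zero_topology S)"
    unfolding near_zero_topology_def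
    by (intro Hausdorff_space_subtopology Hausdorff_space_stone_topology)
next
  fix q assume "q \<in> topspace (near_zero_topology S)"
  then have q: "q \<in> near_zero S" by simp
  have "continuous_map (near_zero_topology S) (stone_topology S) (\<lambda>p. ultrafilter_add S p q)"
  proof (rule continuous_map_into_stone_topology)
    show "ultrafilter_add S p q \<in> ultrafilters S" if "p \<in> topspace (near_zero_topology S)" for p
      using near_zero_add_closed[OF S _ q] near_zero_ultrafilters that by auto
    \<comment> \<open>For fixed \<open>q\<close> and \<open>A\<close>, the condition on
      \<open>p\<close> is membership of one fixed set, hence clopen.\<close>
    show "continuous_map (near_zero_topology S) (discrete_topology UNIV)
        (\<lambda>p. A \<in> ultrafilter_add S p q)" for A
    proof (cases "A \<subseteq> S")
      case True
      then show ?thesis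
        using continuous_map_from_subtopology[OF continuous_map_mem_stone_topology]
        by (simp add: ultrafilter_add_mem_iff near_zero_topology_def)
    qed (simp add: ultrafilter_add_mem_iff)
  qed
  then show "continuous_map (near_zero_topology S) (near_zero_topology S)
      (\<lambda>p. ultrafilter_add S p q)"
    using near_zero_add_closed[OF S _ q]
    by (subst (2) near_zero_topology_def) (auto simp: continuous_map_in_subtopology)
next
  show "ultrafilter_add S p q \<in> topspace (near_zero_topology S)"
    if "p \<in> topspace (near_zero_topology S)" "q \<in> topspace (near_zero_topology S)" for p q
    using near_zero_add_closed[OF S] that by simp
next
  show "ultrafilter_add S (ultrafilter_add S p q) r = ultrafilter_add S p (ultrafilter_add S q r)"
    for p q r
    by (rule ultrafilter_add_assoc[OF S])
qed

section \<open>Pushforwards of ultrafilters\<close>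

definition ultrafilter_map :: "('a \<Rightarrow> 'b) \<Rightarrow> 'a set \<Rightarrow> 'b set \<Rightarrow> 'a set set \<Rightarrow> 'b set set" where
  "ultrafilter_map h S T p = {A. A \<subseteq> T \<and> {x \<in> S. h x \<in> A} \<in> p}"

lemma ultrafilter_map_closed:
  assumes h: "\<And>x. x \<in> S \<Longrightarrow> h x \<in> T" and p: "p \<in> ultrafilters S"
  shows "ultrafilter_map h S T p \<in> ultrafilters T"
  unfolding ultrafilters_iff
proof (intro conjI allI impI)
  show "ultrafilter_map h S T p \<subseteq> Pow T" by (auto simp: ultrafilter_map_def)
  fix A assume A: "A \<subseteq> T"
  have "{x \<in> S. h x \<in> T - A} = S - {x \<in> S. h x \<in> A}" using h by auto
  then show "T - A \<in> ultrafilter_map h S T p \<longleftrightarrow> A \<notin> ultrafilter_map h S T p"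
    using A ultrafilters_Diff_iff[OF p, of "{x \<in> S. h x \<in> A}"]
    by (auto simp: ultrafilter_map_def)
  fix B assume B: "B \<subseteq> T"
  have "{x \<in> S. h x \<in> A \<inter> B} = {x \<in> S. h x \<in> A} \<inter> {x \<in> S. h x \<in> B}" by auto
  then show "A \<inter> B \<in> ultrafilter_map h S T p \<longleftrightarrow>
      A \<in> ultrafilter_map h S T p \<and> B \<in> ultrafilter_map h S T p"
    using A B ultrafilters_Int_iff[OF p, of "{x \<in> S. h x \<in> A}" "{x \<in> S. h x \<in> B}"]
    by (auto simp: ultrafilter_map_def)
qed

text \<open>Additivity makes the translate by \<open>x\<close> of a preimage under \<open>h\<close>
  the preimage of the translate by \<open>h x\<close>.\<close>

lemma ultrafilter_map_add:
  assumes h: "\<And>x. x \<in> S \<Longrightarrow> h x \<in> T"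
    and add: "\<And>x y. x \<in> S \<Longrightarrow> y \<in> S \<Longrightarrow> h (x + y) = h x + h y"
    and S: "\<And>s t. s \<in> S \<Longrightarrow> t \<in> S \<Longrightarrow> s + t \<in> S"
  shows "ultrafilter_map h S T (ultrafilter_add S p q)
    = ultrafilter_add T (ultrafilter_map h S T p) (ultrafilter_map h S T q)"
proof -
  have sub: "left_translate T t A \<subseteq> T" for t A by (auto simp: left_translate_def)
  have "left_translate S x {x \<in> S. h x \<in> A} = {y \<in> S. h y \<in> left_translate T (h x) A}"
    if "x \<in> S" for x A
    using h add S that by (auto simp: left_translate_def)
  then have "{x \<in> S. left_translate S x {x \<in> S. h x \<in> A} \<in> q}
      = {x \<in> S. h x \<in> {t \<in> T. left_translate T t A \<in> ultrafilter_map h S T q}}" for A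
    using h sub by (auto simp: ultrafilter_map_def)
  then show ?thesis
    by (auto simp: ultrafilter_map_def[of h S T p] ultrafilter_map_def[of h S T "ultrafilter_add S p q"]
        ultrafilter_add_mem_iff)
qed

lemma ultrafilter_map_near_zero:
  fixes h :: "'a::{topological_space, zero} \<Rightarrow> 'b::{topological_space, zero}"
  assumes h: "\<And>x. x \<in> S \<Longrightarrow> h x \<in> T" and cont: "continuous_on UNIV h" and "h 0 = 0"
    and p: "p \<in> near_zero S"
  shows "ultrafilter_map h S T p \<in> near_zero T"
  unfolding near_zero_def
proof (intro CollectI conjI allI impI)
  show "ultrafilter_map h S T p \<in> ultrafilters T"
    using ultrafilter_map_closed h near_zero_ultrafilters p by blast
  fix U :: "'b set" assume U: "open U \<and> 0 \<in> U"
  then have "open (h -` U)" using cont open_vimage by blast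
  then have "h -` U \<inter> S \<in> p" using U \<open>h 0 = 0\<close> by (intro near_zero_mem[OF p]) auto
  moreover have "h -` U \<inter> S = {x \<in> S. h x \<in> U \<inter> T}" using h by auto
  ultimately show "U \<inter> T \<in> ultrafilter_map h S T p" by (simp add: ultrafilter_map_def)
qed

lemma continuous_map_ultrafilter_map:
  fixes h :: "'a::{topological_space, zero} \<Rightarrow> 'b::{topological_space, zero}"
  assumes h: "\<And>x. x \<in> S \<Longrightarrow> h x \<in> T" and cont: "continuous_on UNIV h" and "h 0 = 0"
  shows "continuous_map (near_zero_topology S) (near_zero_topology T) (ultrafilter_map h S T)"
proof -
  have "continuous_map (near_zero_topology S) (stone_topology T) (ultrafilter_map h S T)"
  proof (rule continuous_map_into_stone_topology)
    show "ultrafilter_map h S T p \<in> ultrafilters T" if "p \<in> topspace (near_zero_topology S)" for p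
      using ultrafilter_map_closed[of S h T p, OF h] near_zero_ultrafilters[of p S] that by simp
    show "continuous_map (near_zero_topology S) (discrete_topology UNIV)
        (\<lambda>p. A \<in> ultrafilter_map h S T p)" for A
    proof (cases "A \<subseteq> T")
      case True
      then show ?thesis
        using continuous_map_from_subtopology[OF continuous_map_mem_stone_topology]
        by (simp add: ultrafilter_map_def near_zero_topology_def)
    qed (simp add: ultrafilter_map_def)
  qed
  then show ?thesis
    using ultrafilter_map_near_zero[of S h T, OF h cont \<open>h 0 = 0\<close>]
    by (subst (2) near_zero_topology_def) (auto simp: continuous_map_in_subtopology)
qed

text \<open>The traces on \<open>S\<close> of the open neighborhoods of 0 form a filter
  base.\<close>

lemma near_zero_nonempty:
  assumes "0 \<in> closure S"
  shows "near_zero S \<noteq> {}"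
proof -
  let ?\<G> = "(\<lambda>U. U \<inter> S) ` {U. open U \<and> 0 \<in> U}"
  have "\<exists>p\<in>ultrafilters S. ?\<G> \<subseteq> p"
  proof (rule ex_ultrafilter)
    show "?\<G> \<noteq> {}" using open_UNIV by blast
    show "{} \<notin> ?\<G>" using assms by (auto simp: closure_iff_nhds_not_empty)
    show "A \<inter> B \<in> ?\<G>" if "A \<in> ?\<G>" "B \<in> ?\<G>" for A B
    proof -
      obtain U V where "open U" "0 \<in> U" "open V" "0 \<in> V" "A = U \<inter> S" "B = V \<inter> S"
        using \<open>A \<in> ?\<G>\<close> \<open>B \<in> ?\<G>\<close> by auto
      then show ?thesis by (intro image_eqI[of _ _ "U \<inter> V"]) auto
    qed
  qed auto
  then obtain p where p: "p \<in> ultrafilters S" "?\<G> \<subseteq> p" by blast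
  then have "p \<in> near_zero S" unfolding near_zero_def by blast
  then show ?thesis by blast
qed

section \<open>Image partition regularity near zero\<close>

lemma map_matrix_real_mult_nth:
  "(map_matrix real A *v x) $ i = (\<Sum>j\<in>UNIV. real (A $ i $ j) * x $ j)"
  by (simp add: matrix_vector_mult_def map_matrix_def)

text \<open>Adjoining 0 to \<open>S\<close> accommodates zero coefficients in the induction. One
  nonzero coefficient makes the sum positive, which excludes the adjoined 0 at the end.\<close>

lemma nonneg_combination_mem:
  fixes S :: "real set" and a :: "'j \<Rightarrow> nat"
  assumes S_pos: "S \<subseteq> {0<..}" and S_add: "\<And>s t. s \<in> S \<Longrightarrow> t \<in> S \<Longrightarrow> s + t \<in> S"
    and J: "finite J" "\<And>j. j \<in> J \<Longrightarrow> x j \<in> S" "\<exists>j\<in>J. a j \<noteq> 0"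
  shows "(\<Sum>j\<in>J. real (a j) * x j) \<in> S"
proof -
  let ?T = "insert 0 S"
  have add: "s + t \<in> ?T" if "s \<in> ?T" "t \<in> ?T" for s t using S_add that by auto
  have mult: "real n * s \<in> ?T" if s: "s \<in> S" for n s
  proof (induction n)
    case (Suc n)
    have "s + real n * s \<in> ?T" using add[OF _ Suc] s by blast
    then show ?case by (simp add: algebra_simps)
  qed simp
  have "(\<Sum>j\<in>J. real (a j) * x j) \<in> ?T"
    using J(1,2)
  proof (induction rule: finite_induct)
    case (insert j J)
    have "real (a j) * x j + (\<Sum>j\<in>J. real (a j) * x j) \<in> ?T"
      by (rule add) (use insert mult in auto)
    then show ?case using insert(1,2) by simp
  qed simp
  moreover have "(\<Sum>j\<in>J. real (a j) * x j) > 0"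
  proof -
    obtain j where j: "j \<in> J" "a j \<noteq> 0" using J(3) by blast
    have pos: "x k > 0" if "k \<in> J" for k using J(2)[OF that] S_pos by auto
    show ?thesis
      using j pos by (intro sum_pos2[OF J(1) j(1)]) (auto intro!: mult_nonneg_nonneg intro: less_imp_le)
  qed
  ultimately show ?thesis by auto
qed

lemma central_near_zeroI:
  assumes "p \<in> smallest_ideal (ultrafilter_add S) (near_zero S)" "ultrafilter_add S p p = p" "C \<in> p"
  shows "central_near_zero S C"
  using assms unfolding central_near_zero_def by blast

theorem theorem3p18:
  fixes A :: "nat ^ 'v ^ 'u" and S :: "real set"
  assumes rows: "\<forall>i. row i A \<noteq> 0"
    and S_pos: "S \<subseteq> {0<..}"
    and S_add: "\<forall>s\<in>S. \<forall>t\<in>S. s + t \<in> S"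
    and S_dense: "{0..} \<subseteq> closure S"
    and hyp: "\<forall>C. central_near_zero S C \<longrightarrow>
      (\<exists>x \<in> cart_power S. map_matrix real A *v x \<in> cart_power C)"
  shows "\<forall>C. central_near_zero S C \<longrightarrow>
      central_near_zero (cart_power S :: (real ^ 'v) set)
        {x \<in> cart_power S. map_matrix real A *v x \<in> cart_power C}"
proof (intro allI impI)
  fix C assume "central_near_zero S C"
  then obtain p where p: "p \<in> smallest_ideal (ultrafilter_add S) (near_zero S)"
    "ultrafilter_add S p p = p" "C \<in> p"
    by (auto simp: central_near_zero_def)
  define V :: "(real ^ 'v) set" where "V = cart_power S"
  define h where "h i x = (map_matrix real A *v x) $ i" for i and x :: "real ^ 'v"
  have h_sum: "h i x = (\<Sum>j\<in>UNIV. real (A $ i $ j) * x $ j)" for i x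
    by (simp add: h_def map_matrix_real_mult_nth)
  have S_add': "s + t \<in> S" if "s \<in> S" "t \<in> S" for s t using S_add that by blast
  have V_add: "x + y \<in> V" if "x \<in> V" "y \<in> V" for x y
    using that S_add' by (auto simp: V_def cart_power_def)
  have h_mem: "h i x \<in> S" if "x \<in> V" for i x
  proof -
    have "\<exists>j. A $ i $ j \<noteq> 0"
      using rows by (auto simp: row_def vec_eq_iff)
    then show ?thesis
      unfolding h_sum using that
      by (intro nonneg_combination_mem[OF S_pos S_add']) (auto simp: V_def cart_power_def)
  qed
  have h_add: "h i (x + y) = h i x + h i y" for i x y
    by (simp add: h_sum algebra_simps sum.distrib)
  have h_cont: "continuous_on UNIV (h i)" for i
    unfolding h_sum by (intro continuous_intros)
  have h_0: "h i 0 = 0" for i by (simp add: h_sum)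

  interpret S: compact_right_topological_semigroup "near_zero_topology S" "ultrafilter_add S"
    by (rule near_zero_semigroup[OF S_add'])
  interpret V: compact_right_topological_semigroup "near_zero_topology V" "ultrafilter_add V"
    by (rule near_zero_semigroup[OF V_add])

  \<comment> \<open>The formula for the smallest ideal is available for nonempty semigroups, and it
    is what places \<open>p\<close> in \<open>near_zero S\<close>.\<close>
  have "0 \<in> closure S" using S_dense by auto
  then have "near_zero S \<noteq> {}" by (rule near_zero_nonempty)
  then have p_near: "p \<in> near_zero S"
    using p(1) S.smallest_ideal_topspace by auto
  note p_ultra = near_zero_ultrafilters[OF p_near]

  \<comment> \<open>The filter base for \<open>r\<close>: \<open>U\<close> forces \<open>r\<close>
    to be near zero, and \<open>D\<close> forces every row to map \<open>r\<close> to an ultrafilter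
    containing \<open>p\<close>.\<close>
  let ?W = "\<lambda>U D. {x \<in> V. x \<in> U \<and> (\<forall>i. h i x \<in> D)}"
  define \<G> where "\<G> = {?W U D | U D. open U \<and> 0 \<in> U \<and> D \<in> p}"
  have nonempty: "?W U D \<noteq> {}" if U: "open U" "0 \<in> U" and D: "D \<in> p" for U D
  proof -
    obtain e where e: "e > 0" "ball 0 e \<subseteq> U" using U open_contains_ball by blast
    \<comment> \<open>Coordinates below \<open>d\<close> give an l1 norm of at most
      \<open>e / 2\<close>, strictly inside the ball of radius \<open>e\<close>.\<close>
    define d where "d = e / (2 * CARD('v))"
    have d: "d > 0" using e by (simp add: d_def)
    have "{..<d} \<inter> S \<in> p" using near_zero_mem[OF p_near, of "{..<d}"] d by simp
    \<comment> \<open>Cutting \<open>D\<close> down to small elements keeps it in \<open>p\<close>,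
      hence central, so \<open>hyp\<close> yields an \<open>x\<close> with small images under all
      rows.\<close>
    then have "D \<inter> ({..<d} \<inter> S) \<in> p"
      using D ultrafilters_Int_iff[OF p_ultra] ultrafilters_subset[OF p_ultra] by blast
    then have "central_near_zero S (D \<inter> ({..<d} \<inter> S))" using central_near_zeroI p by blast
    then obtain x :: "real ^ 'v" where "x \<in> cart_power S"
      "map_matrix real A *v x \<in> cart_power (D \<inter> ({..<d} \<inter> S))"
      using hyp by blast
    then have x: "\<And>j. x $ j \<in> S" "\<And>i. h i x \<in> D" "\<And>i. h i x < d"
      by (auto simp: cart_power_def h_def)
    obtain s where s: "s \<in> S" "s < d"
      using ultrafilters_nonempty[OF p_ultra \<open>{..<d} \<inter> S \<in> p\<close>] by auto
    \<comment> \<open>Smallness of \<open>A x\<close> bounds only the coordinates of \<open>x\<close> whose column of \<open>A\<close> is nonzero;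
      the others do not affect \<open>A x\<close> and can be replaced by a small element of \<open>S\<close>.\<close>
    define y :: "real ^ 'v" where "y = (\<chi> j. if \<forall>i. A $ i $ j = 0 then s else x $ j)"
    have hy: "h i y = h i x" for i
      unfolding h_sum by (intro sum.cong) (auto simp: y_def)
    have y_S: "y $ j \<in> S" for j using s x by (simp add: y_def)
    have pos: "x $ j > 0" "y $ j > 0" for j using x(1) y_S S_pos by auto
    have y_d: "y $ j < d" for j
    proof (cases "\<forall>i. A $ i $ j = 0")
      case False
      then obtain i where i: "A $ i $ j \<noteq> 0" by blast
      \<comment> \<open>A nonzero natural entry is at least 1 and all terms of the row sum are
        nonnegative, so \<open>x $ j\<close> is bounded by \<open>h i x\<close>.\<close>
      then have "1 * x $ j \<le> real (A $ i $ j) * x $ j"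
        using pos(1)[of j] by (intro mult_right_mono) auto
      also have "\<dots> \<le> h i x"
        unfolding h_sum using pos(1)
        by (intro member_le_sum) (auto intro!: mult_nonneg_nonneg intro: less_imp_le)
      also have "\<dots> < d" by (rule x(3))
      finally show ?thesis using i by (auto simp: y_def)
    qed (simp add: y_def s)
    have "norm y \<le> (\<Sum>j\<in>UNIV. \<bar>y $ j\<bar>)" by (rule norm_le_l1_cart)
    also have "\<dots> \<le> (\<Sum>j\<in>(UNIV :: 'v set). d)"
      using y_d pos(2) by (intro sum_mono) (simp add: less_imp_le)
    also have "\<dots> = e / 2" by (simp add: d_def)
    also have "\<dots> < e" using e by simp
    finally have "y \<in> U" using e by auto
    moreover have "y \<in> V" using y_S by (simp add: V_def cart_power_def)
    ultimately have "y \<in> ?W U D" using hy x(2) by simp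
    then show ?thesis by blast
  qed
  have "\<exists>r\<in>ultrafilters V. \<G> \<subseteq> r"
  proof (rule ex_ultrafilter)
    show "\<G> \<subseteq> Pow V" by (auto simp: \<G>_def)
    show "\<G> \<noteq> {}" using p(3) open_UNIV by (auto simp: \<G>_def)
    show "{} \<notin> \<G>" unfolding \<G>_def using nonempty by blast
    show "X \<inter> Y \<in> \<G>" if X: "X \<in> \<G>" and Y: "Y \<in> \<G>" for X Y
    proof -
      obtain U D where U: "open U" "0 \<in> U" "D \<in> p" "X = ?W U D" using X by (auto simp: \<G>_def)
      obtain U' D' where U': "open U'" "0 \<in> U'" "D' \<in> p" "Y = ?W U' D'"
        using Y by (auto simp: \<G>_def)
      have "D \<inter> D' \<in> p"
        using U U' ultrafilters_Int_iff[OF p_ultra] ultrafilters_subset[OF p_ultra] by blast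
      moreover have "X \<inter> Y = ?W (U \<inter> U') (D \<inter> D')" using U U' by auto
      ultimately show ?thesis
        unfolding \<G>_def using open_Int[OF U(1) U'(1)] U(2) U'(2) by blast
    qed
  qed
  then obtain r where r: "r \<in> ultrafilters V" "\<G> \<subseteq> r" by blast
  have r_W: "?W U D \<in> r" if "open U" "0 \<in> U" "D \<in> p" for U D
    using r(2) that unfolding \<G>_def by blast
  have S_p: "S \<in> p" using near_zero_mem[OF p_near open_UNIV] by simp
  have r_near: "r \<in> near_zero V"
    unfolding near_zero_def
  proof (intro CollectI conjI allI impI)
    fix U :: "(real ^ 'v) set" assume "open U \<and> 0 \<in> U"
    then show "U \<inter> V \<in> r"
      using ultrafilters_mono[OF r(1) r_W[of U S], of "U \<inter> V"] S_p by auto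
  qed (rule r(1))
  \<comment> \<open>One inclusion suffices, since an ultrafilter contained in another equals
    it.\<close>
  have r_map: "ultrafilter_map (h i) V S r = p" for i
  proof (rule ultrafilters_eqI[symmetric, OF p_ultra])
    show "ultrafilter_map (h i) V S r \<in> ultrafilters S"
      using ultrafilter_map_closed[of V "h i" S r, OF h_mem r(1)] .
    show "p \<subseteq> ultrafilter_map (h i) V S r"
    proof
      fix D assume D: "D \<in> p"
      have "{x \<in> V. h i x \<in> D} \<in> r"
        by (rule ultrafilters_mono[OF r(1) r_W[OF open_UNIV UNIV_I D]]) auto
      then show "D \<in> ultrafilter_map (h i) V S r"
        using ultrafilters_subset[OF p_ultra D] by (simp add: ultrafilter_map_def)
    qed
  qed

  have "\<exists>q\<in>smallest_ideal (ultrafilter_add V) (topspace (near_zero_topology V)).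
      ultrafilter_add V q q = q \<and> (\<forall>i\<in>UNIV. ultrafilter_map (h i) V S q = p)"
  proof (rule minimal_idempotent_lift[OF V.compact_right_topological_semigroup_axioms
        S.compact_right_topological_semigroup_axioms])
    show "continuous_map (near_zero_topology V) (near_zero_topology S) (ultrafilter_map (h i) V S)"
      for i
      by (rule continuous_map_ultrafilter_map[of V "h i" S, OF h_mem h_cont h_0])
    show "ultrafilter_map (h i) V S (ultrafilter_add V x y) =
        ultrafilter_add S (ultrafilter_map (h i) V S x) (ultrafilter_map (h i) V S y)" for i x y
      by (rule ultrafilter_map_add[of V "h i" S, OF h_mem h_add V_add])
  qed (use p p_near r_near r_map in simp_all)
  then obtain q where q: "q \<in> smallest_ideal (ultrafilter_add V) (near_zero V)"
    "ultrafilter_add V q q = q" "\<And>i. ultrafilter_map (h i) V S q = p"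
    by auto
  have "near_zero V \<noteq> {}" using r_near by blast
  then have q_ultra: "q \<in> ultrafilters V"
    using q(1) V.smallest_ideal_topspace near_zero_ultrafilters[of q V] by simp
  have V_q: "V \<in> q"
    using q_ultra by (simp add: ultrafilters_def ultrafilter_on_def)
  have h_q: "{x \<in> V. h i x \<in> C} \<in> q" for i
    using p(3) q(3)[of i] by (auto simp: ultrafilter_map_def)
  \<comment> \<open>Each row gives a member of \<open>q\<close>; finite intersections combine them,
    and the row index type is finite.\<close>
  have "{x \<in> V. \<forall>i\<in>I. h i x \<in> C} \<in> q" if "finite I" for I
    using that
  proof (induction I rule: finite_induct)
    case (insert i I)
    have "{x \<in> V. \<forall>k\<in>insert i I. h k x \<in> C}
        = {x \<in> V. h i x \<in> C} \<inter> {x \<in> V. \<forall>k\<in>I. h k x \<in> C}" by auto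
    then show ?case
      using ultrafilters_Int_iff[OF q_ultra, of "{x \<in> V. h i x \<in> C}" "{x \<in> V. \<forall>k\<in>I. h k x \<in> C}"]
        h_q insert.IH by auto
  qed (simp add: V_q)
  from this[of UNIV] have "{x \<in> V. \<forall>i. h i x \<in> C} \<in> q" by simp
  then have "central_near_zero V {x \<in> V. \<forall>i. h i x \<in> C}"
    using central_near_zeroI q by blast
  then show "central_near_zero (cart_power S :: (real ^ 'v) set)
      {x \<in> cart_power S. map_matrix real A *v x \<in> cart_power C}"
    by (simp add: V_def h_def cart_power_def)
qed

end
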